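(* For any $n\ge2$, $\mathbf{m}$ with $m_i\ge 2$, and any $t\in\mathbb{N}$, $$\Pr\left[t<H<\infty\right]\le\exp\left\{-\frac{\left(\left\lfloor\frac{t}{n}-1\right\rfloor\right)^2}{2q_{n,\mathbf{m}}}\right\},$$ where $H=\inf\{\tau\ge 1:\mathbf{A}^\tau \text{ is a PNE of } G_{n,\mathbf{m}}\}$ is the hitting time of the set of PNE by the clockwork best-response dynamic.
   Context: A random game $G_{n,\mathbf{m}}$ has $n\ge 2$ players; player $i$ has action set $[m_i]=\{1,\dots,m_i\}$, $m_i\ge2$; $\mathcal{M}=\times_i[m_i]$. Payoffs $U_i(\mathbf{a})$ are drawn from a fixed atomless distribution on $\mathbb{R}$, independently across $i$ and $\mathbf{a}\in\mathcal{M}$. The best response $B_i(\mathbf{a}_{-i})=\arg\max_{x\in[m_i]}U_i(x,\mathbf{a}_{-i})$ is a.s. unique; a PNE is a profile $\mathbf{a}$ with $a_i=B_i(\mathbf{a}_{-i})$ for all $i$. The clockwork sequence is $s_{\texttt{c}}(t)=1+((t-1)\bmod n)$. The clockwork best-response dynamic: $\mathbf{A}^0$ uniform on $\mathcal{M}$ independent of payoffs; for $t\ge1$ with $i=s_{\texttt{c}}(t)$, $A^t_j=A^{t-1}_j$ ($j\ne i$) and $A^t_i=B_i(\mathbf{A}^{t-1}_{-i})$. $q_{n,\mathbf{m}}=\prod_i m_i/\max_i m_i$. $\inf\emptyset=\infty$. *)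

theory Defs
  imports "HOL-Probability.Probability"
begin

(* Players are 0,...,n-1 (player i here = player i+1 of the paper);
   player i has actions 0,...,m i - 1 (action x here = action x+1 of the paper).
   Profiles are extensional functions on {0..<n}. *)
definition profiles :: "nat \<Rightarrow> (nat \<Rightarrow> nat) \<Rightarrow> (nat \<Rightarrow> nat) set" where
  "profiles n m = PiE {0..<n} (\<lambda>i. {0..<m i})"

(* payoff U (i, a) of player i at profile a *)
type_synonym payoff = "nat \<times> (nat \<Rightarrow> nat) \<Rightarrow> real"

(* best response of player i against a_{-i} (the i-th entry of a is ignored);
   a.s. unique; ties (probability zero) broken towards the least action *)
definition best_resp :: "(nat \<Rightarrow> nat) \<Rightarrow> payoff \<Rightarrow> nat \<Rightarrow> (nat \<Rightarrow> nat) \<Rightarrow> nat" where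
  "best_resp m U i a =
     (LEAST x. x < m i \<and> (\<forall>y < m i. U (i, a(i := y)) \<le> U (i, a(i := x))))"

definition is_PNE :: "nat \<Rightarrow> (nat \<Rightarrow> nat) \<Rightarrow> payoff \<Rightarrow> (nat \<Rightarrow> nat) \<Rightarrow> bool" where
  "is_PNE n m U a \<longleftrightarrow> (\<forall>i<n. a i = best_resp m U i a)"

(* clockwork best-response dynamic: at step t+1 (t \<ge> 0) the player t mod n
   (= player 1 + ((t+1)-1) mod n in the paper's 1-based indexing) best-responds *)
primrec clockwork :: "nat \<Rightarrow> (nat \<Rightarrow> nat) \<Rightarrow> payoff \<Rightarrow> (nat \<Rightarrow> nat) \<Rightarrow> nat \<Rightarrow> (nat \<Rightarrow> nat)" where
  "clockwork n m U a0 0 = a0"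
| "clockwork n m U a0 (Suc t) =
     (clockwork n m U a0 t)(t mod n := best_resp m U (t mod n) (clockwork n m U a0 t))"

definition hit_time :: "nat \<Rightarrow> (nat \<Rightarrow> nat) \<Rightarrow> payoff \<Rightarrow> (nat \<Rightarrow> nat) \<Rightarrow> enat" where
  "hit_time n m U a0 = Inf (enat ` {\<tau>. 1 \<le> \<tau> \<and> is_PNE n m U (clockwork n m U a0 \<tau>)})"

definition q_nm :: "nat \<Rightarrow> (nat \<Rightarrow> nat) \<Rightarrow> real" where
  "q_nm n m = real (\<Prod>i<n. m i) / real (Max (m ` {0..<n}))"

definition game_space :: "nat \<Rightarrow> (nat \<Rightarrow> nat) \<Rightarrow> real measure \<Rightarrow> (payoff \<times> (nat \<Rightarrow> nat)) measure" where
  "game_space n m D =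
     (PiM ({0..<n} \<times> profiles n m) (\<lambda>_. D)) \<Otimes>\<^sub>M measure_pmf (pmf_of_set (profiles n m))"

end

theory Submission
  imports Defs
begin

text \<open>
  A game run is determined by the initial profile and the successive responses. As long as no
  player is asked twice about the same context (the actions of the other players), the responses
  are independent and uniform, because relabelling a player's actions in each context
  separately preserves the payoff distribution. Hence every word of length \<open>N\<close> without a repeated
  query is the history of the game with the same probability, one over the number of words.

  A repeated query makes the dynamic periodic, so on \<open>t < H < \<infinity>\<close> no query is repeated up to time
  \<open>t\<close>. In particular a player \<open>k\<close> with the most actions sees distinct contexts in the first
  \<open>R = \<lfloor>t / n\<rfloor>\<close> rounds, and there are \<open>q\<close> of them: the birthday bound gives \<open>exp (- R (R - 1) / (2 q))\<close>.

  For \<open>t < n\<close> the floor in the claim is \<open>-1\<close> and its square is \<open>1\<close>, so the bound is not trivial.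
  Here one uses that the first step reaches an equilibrium with probability \<open>m\<^sub>0 / (q m\<^sub>k)\<close>,
  and that the dynamic cycles, the contexts of \<open>k\<close> being \<open>c, c', c\<close> in its first three turns, with
  probability at least \<open>(1 - 1/m\<^sub>k) (1 - 2/m\<^sub>k) (1 - 1/q) / q\<close>; these add up to at least \<open>1 / (2 q)\<close>.
\<close>

section \<open>Injective functions and elementary inequalities\<close>

lemma card_PiE_inj_on:
  assumes "finite S" "finite T"
  shows "card {f \<in> S \<rightarrow>\<^sub>E T. inj_on f S} = (\<Prod>r<card S. card T - r)"
  using assms
proof (induction S arbitrary: T rule: finite_induct)
  case empty
  then show ?case by (simp add: Collect_conv_if PiE_empty_domain)
next
  case (insert x S)
  let ?G = "SIGMA y:T. {g \<in> S \<rightarrow>\<^sub>E (T - {y}). inj_on g S}"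
  have G: "?G = {(y, g). y \<in> T \<and> g \<in> S \<rightarrow>\<^sub>E (T - {y}) \<and> inj_on g S}"
    by auto
  have fin: "finite {g \<in> S \<rightarrow>\<^sub>E (T - {y}). inj_on g S}" for y
    using insert.hyps(1) insert.prems
    by (intro finite_subset[OF _ finite_PiE[of S "\<lambda>_. T - {y}"]]) auto
  have "card {f \<in> insert x S \<rightarrow>\<^sub>E T. inj_on f (insert x S)} = card ?G"
    unfolding G extensional_funcset_extend_domain_inj_on_eq[OF insert.hyps(2)]
    by (rule card_image[OF extensional_funcset_extend_domain_inj_onI[OF insert.hyps(2)]])
  also have "\<dots> = (\<Sum>y\<in>T. \<Prod>r<card S. card T - 1 - r)"
    using insert.prems by (subst card_SigmaI) (auto simp: fin insert.IH)
  also have "\<dots> = (\<Prod>r<card (insert x S). card T - r)"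
    using insert.hyps by (simp add: prod.lessThan_Suc_shift del: prod.lessThan_Suc)
  finally show ?case .
qed

lemma prod_falling_le_exp:
  fixes q R :: nat
  assumes "0 < q"
  shows "(\<Prod>r<R. real (q - r) / real q) \<le> exp (- (real R * (real R - 1)) / (2 * real q))"
proof -
  have "(\<Prod>r<R. real (q - r) / real q) \<le> (\<Prod>r<R. exp (- real r / real q))"
  proof (intro prod_mono conjI)
    fix r
    show "real (q - r) / real q \<le> exp (- real r / real q)"
    proof (cases "r \<le> q")
      case True
      then have "real (q - r) / real q = 1 + - real r / real q"
        using assms by (simp add: of_nat_diff field_simps)
      then show ?thesis using exp_ge_add_one_self[of "- real r / real q"] by simp
    qed simp
  qed auto
  also have "\<dots> = exp (- (real R * (real R - 1)) / (2 * real q))"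
    using assms by (induction R) (simp_all add: field_simps flip: exp_add)
  finally show ?thesis .
qed

lemma card_PiE_inj_on_le_exp:
  assumes "finite B" "B \<noteq> {}"
  shows "card {f \<in> {..<R} \<rightarrow>\<^sub>E B. inj_on f {..<R}} / real (card B) ^ R
    \<le> exp (- (real R * (real R - 1)) / (2 * card B))"
  using prod_falling_le_exp[of "card B" R] assms
  by (simp add: card_PiE_inj_on prod_dividef card_gt_0_iff)

lemma card_PiE_equal_pair: "card {g \<in> {..<2::nat} \<rightarrow>\<^sub>E B. g 1 = g 0} = card B"
  by (rule bij_betw_same_card[of "\<lambda>g. g 0"], rule bij_betw_byWitness[where f' = "\<lambda>b. \<lambda>r\<in>{..<2}. b"])
    (auto simp: PiE_iff extensional_def fun_eq_iff less_2_cases_iff)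

lemma card_PiE_returning_triple:
  assumes "finite B"
  shows "card {g \<in> {..<3::nat} \<rightarrow>\<^sub>E B. g 2 = g 0 \<and> g 1 \<noteq> g 0} = card B * (card B - 1)"
proof -
  have "bij_betw (\<lambda>g. (g 0, g 1)) {g \<in> {..<3::nat} \<rightarrow>\<^sub>E B. g 2 = g 0 \<and> g 1 \<noteq> g 0}
      (SIGMA b:B. B - {b})"
    by (rule bij_betw_byWitness[where f' = "\<lambda>(b, c). \<lambda>r\<in>{..<3}. if r = 1 then c else b"])
      (auto simp: PiE_iff extensional_def fun_eq_iff eval_nat_numeral less_Suc_eq)
  then show ?thesis
    using assms by (simp add: bij_betw_same_card card_SigmaI)
qed

text \<open>The summands bound the probabilities of an equilibrium after one step and of a cycle.\<close>

lemma inverse_twice_le: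
  fixes \<mu> q :: real
  assumes "2 \<le> \<mu>" "2 \<le> q"
  shows "1 / (2 * q) \<le> 2 / \<mu> * (1 / q) + (1 - 1 / \<mu>) * (1 - 2 / \<mu>) * ((1 - 1 / q) / q)"
proof -
  let ?c = "(1 - 1 / \<mu>) * (1 - 2 / \<mu>)"
  have "1 / 2 \<le> 2 / \<mu> + ?c * (1 / 2)"
    using assms(1) by (simp add: field_simps)
  also have "\<dots> \<le> 2 / \<mu> + ?c * (1 - 1 / q)"
    using assms by (intro add_left_mono mult_left_mono mult_nonneg_nonneg) (auto simp: field_simps)
  finally have "1 / 2 / q \<le> (2 / \<mu> + ?c * (1 - 1 / q)) / q"
    using assms(2) by (intro divide_right_mono) auto
  then show ?thesis
    by (simp add: add_divide_distrib)
qed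

section \<open>Positions in rounds\<close>

lemma bij_betw_add_mod: "bij_betw (\<lambda>j. (k + j) mod n) {..<n} {..<n}" for k n :: nat
proof -
  have "inj_on (\<lambda>j. (k + j) mod n) {..<n}"
  proof (rule inj_onI)
    fix j j' assume j: "j \<in> {..<n}" "j' \<in> {..<n}" "(k + j) mod n = (k + j') mod n"
    then have "int j mod int n = int j' mod int n"
      by (metis add_diff_cancel_left' mod_diff_left_eq of_nat_add zmod_int)
    then show "j = j'" using j(1,2) by simp
  qed
  moreover from this have "(\<lambda>j. (k + j) mod n) ` {..<n} = {..<n}"
    by (rule endo_inj_surj[rotated 2]) auto
  ultimately show ?thesis
    by (simp add: bij_betw_def)
qed

lemma bij_betw_add_mod_other:
  fixes k n :: nat
  assumes "0 < n"
  shows "bij_betw (\<lambda>j. (k + j) mod n) {1..<n} ({..<n} - {k mod n})"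
proof -
  have "{1..<n} = {..<n} - {0}" by auto
  moreover have "bij_betw (\<lambda>j. (k + j) mod n) {0} {k mod n}"
    by (simp add: bij_betw_def)
  ultimately show ?thesis
    using bij_betw_DiffI[OF bij_betw_add_mod] assms by simp
qed

lemma mod_add_round: "(k + n * r + j) mod n = (k + j) mod n" for k n r j :: nat
  using mod_mult_self2[of "k + j" n r] by (simp add: add_ac)

lemma prod_lessThan_add: "(\<Prod>s<a + b. f s) = (\<Prod>s<a. f s) * (\<Prod>s<b. f (a + s))" for a b :: nat
  by (induction b) (simp_all add: mult.assoc)

lemma round_cases:
  fixes k n R s :: nat
  assumes "0 < n" "s < k + n * R"
  obtains (initial) "s < k"
    | (move) r where "r < R" "s = k + n * r"
    | (window) r j where "r < R" "j \<in> {1..<n}" "s = k + n * r + j"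
proof (cases "s < k")
  case False
  define r j where "r = (s - k) div n" and "j = (s - k) mod n"
  have s: "s = k + n * r + j"
    using False by (simp add: r_def j_def)
  moreover have "j < n"
    using assms(1) by (simp add: j_def)
  moreover have "r < R"
    using assms False by (simp add: r_def less_mult_imp_div_less mult.commute less_diff_conv2)
  ultimately show thesis
    using that(2)[of r] that(3)[of r j] by (cases "j = 0") auto
qed (rule that)

lemma round_bound:
  fixes k n r R j :: nat
  assumes "r < R" "j < n"
  shows "k + n * r + j < k + n * R"
proof -
  have "n * Suc r \<le> n * R"
    using assms(1) by (intro mult_le_mono2) simp
  with assms(2) show ?thesis by simp
qed

section \<open>Components of a product of atomless measures\<close>

lemma AE_PiM_components_distinct:
  fixes D :: "'a :: {second_countable_topology, t2_space} measure"
  assumes "prob_space D" "sets D = sets borel" "\<And>x. emeasure D {x} = 0" "finite I"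
    and pq: "p \<in> I" "q \<in> I" "p \<noteq> q"
  shows "AE U in PiM I (\<lambda>_. D). U p \<noteq> U q"
proof -
  interpret D: prob_space D by fact
  interpret product_sigma_finite "\<lambda>_. D" ..
  let ?J = "I - {p}" and ?A = "{U \<in> space (PiM I (\<lambda>_. D)). U p = U q}"
  have I: "I = insert p ?J" using pq by auto
  have "(\<lambda>U. U j) \<in> borel_measurable (PiM I (\<lambda>_. D))" if "j \<in> I" for j
    using measurable_component_singleton[OF that, of "\<lambda>_. D"]
    by (simp add: measurable_cong_sets[OF refl assms(2)])
  then have A: "?A \<in> sets (PiM I (\<lambda>_. D))"
    using pq by (intro measurable_equality_set)
  have "emeasure (PiM I (\<lambda>_. D)) ?A = (\<integral>\<^sup>+ U. indicator ?A U \<partial>PiM (insert p ?J) (\<lambda>_. D))"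
    using A I by simp
  also have "\<dots> = (\<integral>\<^sup>+ U. (\<integral>\<^sup>+ y. indicator ?A (U(p := y)) \<partial>D) \<partial>PiM ?J (\<lambda>_. D))"
    using A I assms(4) by (intro product_nn_integral_insert) auto
  also have "\<dots> \<le> (\<integral>\<^sup>+ U. (\<integral>\<^sup>+ y. indicator {U q} y \<partial>D) \<partial>PiM ?J (\<lambda>_. D))"
    using pq by (intro nn_integral_mono) (auto simp: indicator_def)
  also have "\<dots> = 0"
    using assms(2,3) by simp
  finally show ?thesis
    using A by (intro AE_I[of _ _ ?A]) auto
qed

lemma AE_PiM_inj_on:
  fixes D :: "'a :: {second_countable_topology, t2_space} measure"
  assumes "prob_space D" "sets D = sets borel" "\<And>x. emeasure D {x} = 0" "finite I"
  shows "AE U in PiM I (\<lambda>_. D). inj_on U I"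
proof -
  have "AE U in PiM I (\<lambda>_. D). p \<noteq> q \<longrightarrow> U p \<noteq> U q" if "p \<in> I" "q \<in> I" for p q
    using AE_PiM_components_distinct[OF assms that] by (cases "p = q") auto
  then have "AE U in PiM I (\<lambda>_. D). \<forall>p\<in>I. \<forall>q\<in>I. p \<noteq> q \<longrightarrow> U p \<noteq> U q"
    using assms(4) by (intro AE_finite_allI)
  then show ?thesis
    by (auto simp: inj_on_def elim!: eventually_mono)
qed

section \<open>Best responses\<close>

lemma best_resp_update [simp]: "best_resp m U i (a(i := x)) = best_resp m U i a"
  by (simp add: best_resp_def)

lemma best_resp_maximal:
  assumes "0 < m i"
  shows "best_resp m U i a < m i \<and> (\<forall>y<m i. U (i, a(i := y)) \<le> U (i, a(i := best_resp m U i a)))"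
proof -
  let ?S = "(\<lambda>y. U (i, a(i := y))) ` {..<m i}"
  have "Max ?S \<in> ?S"
    using assms by (intro Max_in) auto
  then obtain x where "x < m i" "U (i, a(i := x)) = Max ?S"
    by auto
  then have "x < m i \<and> (\<forall>y<m i. U (i, a(i := y)) \<le> U (i, a(i := x)))"
    by auto
  then show ?thesis
    unfolding best_resp_def by (rule LeastI)
qed

lemma best_resp_less: "0 < m i \<Longrightarrow> best_resp m U i a < m i"
  using best_resp_maximal by blast

lemma best_resp_ge:
  "y < m i \<Longrightarrow> U (i, a(i := y)) \<le> U (i, a(i := best_resp m U i a))"
  using best_resp_maximal[of m i U a] by simp

lemma best_resp_eqI:
  assumes "x < m i" "\<And>y. y < m i \<Longrightarrow> y \<noteq> x \<Longrightarrow> U (i, a(i := y)) < U (i, a(i := x))"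
  shows "best_resp m U i a = x"
proof (rule ccontr)
  assume "best_resp m U i a \<noteq> x"
  then have "U (i, a(i := best_resp m U i a)) < U (i, a(i := x))"
    using assms(1) by (intro assms(2) best_resp_less) auto
  with best_resp_ge[of x m i U a] assms(1) show False by simp
qed

lemma best_resp_cong_context: "a(i := 0) = b(i := 0) \<Longrightarrow> best_resp m U i a = best_resp m U i b"
  by (metis best_resp_update)

section \<open>The clockwork dynamic\<close>

lemma hit_time_greater_iff:
  "enat t < hit_time n m U a \<longleftrightarrow> (\<forall>s. 1 \<le> s \<and> s \<le> t \<longrightarrow> \<not> is_PNE n m U (clockwork n m U a s))"
  unfolding hit_time_def Suc_ile_eq[symmetric] le_Inf_iff by (auto simp: not_less_eq_eq[symmetric])

lemma hit_time_finite_iff: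
  "hit_time n m U a < \<infinity> \<longleftrightarrow> (\<exists>s\<ge>1. is_PNE n m U (clockwork n m U a s))"
  unfolding hit_time_def Inf_less_iff by auto

lemma clockwork_cong:
  assumes "0 < n" "\<And>i a. i < n \<Longrightarrow> best_resp m U i a = best_resp m V i a"
  shows "clockwork n m U a s = clockwork n m V a s"
  using assms by (induction s) auto

lemma hit_time_cong:
  assumes "0 < n" "\<And>i a. i < n \<Longrightarrow> best_resp m U i a = best_resp m V i a"
  shows "hit_time n m U a = hit_time n m V a"
  using assms clockwork_cong[OF assms] by (simp add: hit_time_def is_PNE_def)

lemma clockwork_PNE_stays:
  assumes "0 < n" "is_PNE n m U (clockwork n m U a s)" "s \<le> s'"
  shows "clockwork n m U a s' = clockwork n m U a s"
  using assms(3)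
proof (induction s' rule: dec_induct)
  case (step s')
  have "clockwork n m U a s (s' mod n) = best_resp m U (s' mod n) (clockwork n m U a s)"
    using assms by (auto simp: is_PNE_def)
  with step.IH show ?case by (simp add: fun_upd_idem)
qed simp

lemma clockwork_shift:
  assumes "clockwork n m U a s = clockwork n m U a s'" "s mod n = s' mod n"
  shows "clockwork n m U a (s + d) = clockwork n m U a (s' + d)"
proof (induction d)
  case (Suc d)
  have "(s + d) mod n = (s' + d) mod n"
    using assms(2) by (metis mod_add_left_eq)
  with Suc show ?case by simp
qed (simp add: assms)

text \<open>A repeated query makes the dynamic periodic, so it can be absorbed only by being constant.\<close>

lemma PNE_if_context_repeats:
  assumes "0 < n" "hit_time n m U a < \<infinity>" and s: "s' < s" "s mod n = s' mod n"
    and eq: "(clockwork n m U a s)(s mod n := 0) = (clockwork n m U a s')(s mod n := 0)"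
  shows "is_PNE n m U (clockwork n m U a (Suc s'))"
proof -
  let ?A = "clockwork n m U a" and ?i = "s mod n"
  define d where "d = s - s'"
  have d: "0 < d" "Suc s = Suc s' + d"
    using s(1) by (simp_all add: d_def)
  have "(?A s)(?i := x) = (?A s')(?i := x)" for x
    using eq by (metis fun_upd_upd)
  then have step: "?A (Suc s) = ?A (Suc s')"
    using s(2) best_resp_cong_context[OF eq] by simp
  have period: "?A (Suc s' + j * d) = ?A (Suc s')" for j
  proof (induction j)
    case (Suc j)
    have "?A (Suc s + j * d) = ?A (Suc s' + j * d)"
      using s(2) by (intro clockwork_shift step) (metis mod_Suc_eq)
    with Suc d(2) show ?case by (simp add: add_ac)
  qed simp
  obtain \<tau> where \<tau>: "is_PNE n m U (?A \<tau>)"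
    using assms(2) hit_time_finite_iff by blast
  have "\<tau> \<le> Suc s' + \<tau> * d"
    using d(1) by (simp add: trans_le_add2 le_SucI)
  then have "?A (Suc s' + \<tau> * d) = ?A \<tau>"
    by (rule clockwork_PNE_stays[OF assms(1) \<tau>])
  with \<tau> period show ?thesis by simp
qed

section \<open>Histories as words\<close>

locale game_params =
  fixes n :: nat and m :: "nat \<Rightarrow> nat"
  assumes n_ge_2: "2 \<le> n" and m_ge_2: "i < n \<Longrightarrow> 2 \<le> m i"
begin

lemma n_pos [simp]: "0 < n"
  using n_ge_2 by simp

lemma m_pos: "i < n \<Longrightarrow> 0 < m i"
  using m_ge_2[of i] by simp

lemma profiles_update: "a \<in> profiles n m \<Longrightarrow> i < n \<Longrightarrow> x < m i \<Longrightarrow> a(i := x) \<in> profiles n m"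
  by (auto simp: profiles_def PiE_iff extensional_def)

lemma profiles_less: "a \<in> profiles n m \<Longrightarrow> i < n \<Longrightarrow> a i < m i"
  by (auto simp: profiles_def PiE_iff)

lemma finite_profiles [simp]: "finite (profiles n m)"
  by (auto simp: profiles_def intro: finite_PiE)

lemma profiles_nonempty: "profiles n m \<noteq> {}"
  using m_pos by (fastforce simp: profiles_def PiE_eq_empty_iff)

lemma card_profiles: "card (profiles n m) = (\<Prod>i<n. m i)"
  by (simp add: profiles_def card_PiE lessThan_atLeast0)

text \<open>A context of player \<open>i\<close> (the actions of the other players) is encoded by the profile whose
  \<open>i\<close>-th entry is \<open>0\<close>.\<close>

definition slots :: "(nat \<times> (nat \<Rightarrow> nat)) set" where
  "slots = {(i, c). i < n \<and> c \<in> profiles n m \<and> c i = 0}"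

lemma finite_slots [simp]: "finite slots"
  by (rule finite_subset[of _ "{0..<n} \<times> profiles n m"]) (auto simp: slots_def)

lemma slot_of_profile: "a \<in> profiles n m \<Longrightarrow> i < n \<Longrightarrow> (i, a(i := 0)) \<in> slots"
  by (simp add: slots_def profiles_update m_pos)

text \<open>A word records the initial profile in its first \<open>n\<close> letters, followed by the successive
  responses; \<open>state w s\<close> is the profile after \<open>s\<close> steps.\<close>

definition words :: "nat \<Rightarrow> (nat \<Rightarrow> nat) set" where
  "words N = PiE {..<N} (\<lambda>s. {0..<m (s mod n)})"

primrec state :: "(nat \<Rightarrow> nat) \<Rightarrow> nat \<Rightarrow> nat \<Rightarrow> nat" where
  "state w 0 = restrict w {0..<n}"
| "state w (Suc s) = (state w s)(s mod n := w (n + s))"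

definition query :: "(nat \<Rightarrow> nat) \<Rightarrow> nat \<Rightarrow> nat \<times> (nat \<Rightarrow> nat)" where
  "query w s = (s mod n, (state w s)(s mod n := 0))"

definition window :: "(nat \<Rightarrow> nat) \<Rightarrow> nat \<Rightarrow> nat \<Rightarrow> nat" where
  "window w s = (\<lambda>j\<in>{1..<n}. w (s + j))"

definition history :: "nat \<Rightarrow> payoff \<Rightarrow> (nat \<Rightarrow> nat) \<Rightarrow> nat \<Rightarrow> nat" where
  "history N U a = (\<lambda>s\<in>{..<N}. if s < n then a s
     else best_resp m U (s mod n) (clockwork n m U a (s - n)))"

lemma finite_words [simp]: "finite (words N)"
  by (auto simp: words_def intro: finite_PiE)

lemma card_words: "card (words N) = (\<Prod>s<N. m (s mod n))"
  by (simp add: words_def card_PiE)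

lemma words_less: "w \<in> words N \<Longrightarrow> s < N \<Longrightarrow> w s < m (s mod n)"
  by (auto simp: words_def PiE_iff)

lemma restrict_in_words: "w \<in> words N \<Longrightarrow> M \<le> N \<Longrightarrow> restrict w {..<M} \<in> words M"
  by (auto simp: words_def PiE_iff)

lemma state_eq_letter: "j < n \<Longrightarrow> state w s ((s + j) mod n) = w (s + j)"
proof (induction s arbitrary: j)
  case (Suc s)
  show ?case
  proof (cases "Suc j = n")
    case True
    then have "Suc s + j = n + s" by simp
    then show ?thesis by (simp only: state.simps) simp
  next
    case False
    then have j: "Suc j \<in> {1..<n}" using Suc.prems by simp
    then have "(s + Suc j) mod n \<noteq> s mod n"
      using bij_betwE[OF bij_betw_add_mod_other[OF n_pos, of s]] by blast
    then show ?thesis using Suc.IH[of "Suc j"] j by simp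
  qed
qed simp

lemma state_in_profiles: "w \<in> words (n + L) \<Longrightarrow> s \<le> L \<Longrightarrow> state w s \<in> profiles n m"
proof (induction s)
  case 0
  have "w i < m i" if "i < n" for i
    using words_less[OF 0(1), of i] that by simp
  then show ?case by (auto simp: profiles_def)
next
  case (Suc s)
  then show ?case using words_less[of w "n + L" "n + s"]
    unfolding state.simps by (intro profiles_update) auto
qed

lemma state_undefined: "\<not> i < n \<Longrightarrow> state w s i = undefined"
  by (induction s) auto

lemma query_in_slots: "w \<in> words (n + L) \<Longrightarrow> s \<le> L \<Longrightarrow> query w s \<in> slots"
  by (simp add: query_def slot_of_profile state_in_profiles)

lemma state_update_eq_iff:
  assumes "i < n"
  shows "(state w s)(i := x) = (state w s')(i := x)
    \<longleftrightarrow> (\<forall>j\<in>{..<n} - {i}. state w s j = state w s' j)"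
proof
  assume eq: "\<forall>j\<in>{..<n} - {i}. state w s j = state w s' j"
  show "(state w s)(i := x) = (state w s')(i := x)"
  proof
    fix j
    show "((state w s)(i := x)) j = ((state w s')(i := x)) j"
    proof (cases "j \<in> {..<n} - {i}")
      case True
      with eq show ?thesis by simp
    next
      case False
      then have "j = i \<or> \<not> j < n" by blast
      then show ?thesis by (rule disjE) (simp_all add: state_undefined)
    qed
  qed
qed (metis Diff_iff fun_upd_other singletonI)

lemma query_eq_iff:
  "query w s = query w s' \<longleftrightarrow> s mod n = s' mod n \<and> window w s = window w s'"
proof (cases "s mod n = s' mod n")
  case True
  have shift: "(s' + j) mod n = (s + j) mod n" for j
    using True by (metis mod_add_left_eq)
  have window: "window w s j = state w s ((s + j) mod n)" "window w s' j = state w s' ((s + j) mod n)"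
    if "j \<in> {1..<n}" for j
    using that state_eq_letter[of j w s] state_eq_letter[of j w s']
    by (simp_all add: window_def shift)
  have "window w s = window w s' \<longleftrightarrow> (\<forall>j\<in>{1..<n}. window w s j = window w s' j)"
    by (auto simp: window_def fun_eq_iff)
  also have "\<dots> \<longleftrightarrow> (\<forall>j\<in>{1..<n}. state w s ((s + j) mod n) = state w s' ((s + j) mod n))"
    by (simp add: window)
  also have "\<dots> \<longleftrightarrow> (\<forall>i\<in>{..<n} - {s mod n}. state w s i = state w s' i)"
    unfolding bij_betw_imp_surj_on[OF bij_betw_add_mod_other[OF n_pos], symmetric] by simp
  also have "\<dots> \<longleftrightarrow> (state w s)(s mod n := 0) = (state w s')(s mod n := 0)"
    by (simp add: state_update_eq_iff)
  finally show ?thesis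
    using True by (simp add: query_def)
qed (simp add: query_def)

lemma history_in_words: "a \<in> profiles n m \<Longrightarrow> history N U a \<in> words N"
  using profiles_less by (auto simp: words_def history_def intro!: best_resp_less m_pos)

lemma state_history:
  assumes "a \<in> profiles n m" "n + s \<le> N"
  shows "state (history N U a) s = clockwork n m U a s"
  using assms(2)
proof (induction s)
  case 0
  have "a \<in> extensional {0..<n}" using assms(1) by (simp add: profiles_def PiE_iff)
  with 0 show ?case by (auto simp: history_def fun_eq_iff extensional_def)
qed (simp add: history_def)

lemma history_eq_iff_best_resp:
  assumes a: "a \<in> profiles n m" and w: "w \<in> words (n + L)"
  shows "history (n + L) U a = w \<longleftrightarrow> a = restrict w {0..<n} \<and>
    (\<forall>s<L. best_resp m U (fst (query w s)) (snd (query w s)) = w (n + s))"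
    (is "_ \<longleftrightarrow> _ \<and> ?responses")
proof
  assume eq: "history (n + L) U a = w"
  have state: "state w s = clockwork n m U a s" if "s \<le> L" for s
    using state_history[OF a, of s "n + L" U] that by (simp add: eq)
  moreover have "w (n + s) = best_resp m U (s mod n) (clockwork n m U a s)" if "s < L" for s
    unfolding eq[symmetric] using that by (simp add: history_def)
  ultimately show "a = restrict w {0..<n} \<and> ?responses"
    using state[of 0] by (simp add: query_def)
next
  assume run: "a = restrict w {0..<n} \<and> ?responses"
  then have state: "clockwork n m U a s = state w s" if "s \<le> L" for s
    using that by (induction s) (auto simp: query_def)
  have "history (n + L) U a s = w s" if s: "s < n + L" for s
  proof (cases "s < n")
    case True
    with run show ?thesis by (simp add: history_def)
  next
    case False
    then obtain s' where "s = n + s'" by (metis le_add_diff_inverse not_less)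
    with run s state[of s'] show ?thesis by (simp add: history_def query_def)
  qed
  then show "history (n + L) U a = w"
    using w by (intro ext) (force simp: history_def words_def PiE_iff extensional_def)
qed

definition responses_on :: "(nat \<times> (nat \<Rightarrow> nat)) set \<Rightarrow> payoff \<Rightarrow> nat \<times> (nat \<Rightarrow> nat) \<Rightarrow> nat" where
  "responses_on J U = (\<lambda>p\<in>J. best_resp m U (fst p) (snd p))"

definition answers :: "nat \<Rightarrow> (nat \<Rightarrow> nat) \<Rightarrow> nat \<times> (nat \<Rightarrow> nat) \<Rightarrow> nat" where
  "answers L w = (\<lambda>p\<in>query w ` {..<L}. w (n + the_inv_into {..<L} (query w) p))"

lemma responses_on_in_PiE:
  "J \<subseteq> slots \<Longrightarrow> responses_on J U \<in> PiE J (\<lambda>p. {0..<m (fst p)})"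
  by (auto simp: responses_on_def slots_def intro!: best_resp_less m_pos)

lemma responses_on_eq_iff:
  assumes "v \<in> extensional J"
  shows "responses_on J U = v \<longleftrightarrow> (\<forall>p\<in>J. best_resp m U (fst p) (snd p) = v p)"
  using assms by (auto simp: responses_on_def fun_eq_iff extensional_def)

lemma answers_query:
  "inj_on (query w) {..<L} \<Longrightarrow> s < L \<Longrightarrow> answers L w (query w s) = w (n + s)"
  by (simp add: answers_def the_inv_into_f_f)

lemma answers_in_PiE:
  assumes w: "w \<in> words (n + L)" and fresh: "inj_on (query w) {..<L}"
  shows "answers L w \<in> PiE (query w ` {..<L}) (\<lambda>p. {0..<m (fst p)})"
proof (rule PiE_I)
  fix p assume "p \<in> query w ` {..<L}"
  then obtain s where s: "s < L" "p = query w s" by auto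
  then have "w (n + s) < m (fst p)"
    using words_less[OF w, of "n + s"] by (simp add: query_def)
  with s show "answers L w p \<in> {0..<m (fst p)}"
    by (simp add: answers_query[OF fresh])
qed (simp add: answers_def)

lemma history_eq_iff:
  assumes a: "a \<in> profiles n m" and w: "w \<in> words (n + L)" and fresh: "inj_on (query w) {..<L}"
  shows "history (n + L) U a = w
    \<longleftrightarrow> a = restrict w {0..<n} \<and> responses_on (query w ` {..<L}) U = answers L w"
proof -
  have "answers L w \<in> extensional (query w ` {..<L})"
    using answers_in_PiE[OF w fresh] by (simp add: PiE_iff)
  then show ?thesis
    by (auto simp: history_eq_iff_best_resp[OF a w] responses_on_eq_iff answers_query[OF fresh])
qed

definition num_contexts :: "nat \<Rightarrow> nat" where
  "num_contexts k = (\<Prod>i\<in>{..<n} - {k}. m i)"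

definition blocks :: "nat \<Rightarrow> (nat \<Rightarrow> nat) set" where
  "blocks k = PiE {1..<n} (\<lambda>j. {0..<m ((k + j) mod n)})"

lemma num_contexts_mult: "k < n \<Longrightarrow> num_contexts k * m k = (\<Prod>i<n. m i)"
  by (simp add: num_contexts_def prod.remove mult.commute)

lemma q_nm_eq_num_contexts:
  assumes "k < n" "m k = Max (m ` {0..<n})"
  shows "q_nm n m = num_contexts k"
  using assms m_pos[of k] by (simp add: q_nm_def flip: num_contexts_mult[OF assms(1)])

lemma num_contexts_ge_2:
  assumes "k < n"
  shows "2 \<le> num_contexts k"
proof -
  define j where "j = (if k = 0 then 1 else 0 :: nat)"
  have j: "j \<in> {..<n} - {k}"
    using n_ge_2 by (auto simp: j_def)
  have "m j \<le> num_contexts k"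
    unfolding num_contexts_def using j m_pos
    by (intro dvd_imp_le dvd_prod_eqI[of _ j] prod_pos) auto
  then show ?thesis
    using m_ge_2[of j] j by simp
qed

lemma finite_blocks [simp]: "finite (blocks k)"
  by (auto simp: blocks_def intro: finite_PiE)

lemma card_blocks:
  assumes "k < n"
  shows "card (blocks k) = num_contexts k"
  using prod.reindex_bij_betw[OF bij_betw_add_mod_other[OF n_pos, of k], of m] assms
  by (simp add: blocks_def num_contexts_def card_PiE)

lemma blocks_nonempty: "k < n \<Longrightarrow> blocks k \<noteq> {}"
  using card_blocks num_contexts_ge_2 by fastforce

text \<open>From position \<open>k\<close> on, a word splits into rounds of \<open>n\<close> letters: a move of \<open>k\<close>, followed by the
  moves of the others that form the context \<open>k\<close> faces next.\<close>

definition moves :: "nat \<Rightarrow> nat \<Rightarrow> (nat \<Rightarrow> nat) \<Rightarrow> nat \<Rightarrow> nat" where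
  "moves k R w = (\<lambda>r\<in>{..<R}. w (k + n * r))"

definition windows :: "nat \<Rightarrow> nat \<Rightarrow> (nat \<Rightarrow> nat) \<Rightarrow> nat \<Rightarrow> nat \<Rightarrow> nat" where
  "windows k R w = (\<lambda>r\<in>{..<R}. window w (k + n * r))"

lemma card_words_rounds:
  assumes "k < n"
  shows "card (words (k + n * R)) = card (words k) * m k ^ R * num_contexts k ^ R"
proof (induction R)
  case (Suc R)
  have "(\<Prod>s<k + n * R + n. m (s mod n))
      = (\<Prod>s<k + n * R. m (s mod n)) * (\<Prod>j<n. m ((k + n * R + j) mod n))"
    by (rule prod_lessThan_add)
  also have "(\<Prod>j<n. m ((k + n * R + j) mod n)) = (\<Prod>i<n. m i)"
    by (rule prod.reindex_bij_betw[OF bij_betw_add_mod])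
  finally have "card (words (k + n * Suc R)) = card (words (k + n * R)) * (num_contexts k * m k)"
    using assms by (simp add: card_words num_contexts_mult add_ac)
  with Suc show ?case
    by (simp add: mult_ac)
qed simp

lemma inj_on_rounds:
  "inj_on (\<lambda>w. (restrict w {..<k}, moves k R w, windows k R w)) (words (k + n * R))"
    (is "inj_on ?f _")
proof (rule inj_onI)
  fix w w' assume w: "w \<in> words (k + n * R)" "w' \<in> words (k + n * R)" and eq: "?f w = ?f w'"
  have "w s = w' s" if "s < k + n * R" for s
    using n_pos that
  proof (cases rule: round_cases)
    case initial
    moreover have "restrict w {..<k} s = restrict w' {..<k} s" using eq by simp
    ultimately show ?thesis by simp
  next
    case (move r)
    moreover have "moves k R w r = moves k R w' r" using eq by simp
    ultimately show ?thesis by (simp add: moves_def)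
  next
    case (window r j)
    moreover have "windows k R w r j = windows k R w' r j" using eq by simp
    ultimately show ?thesis by (simp add: windows_def window_def)
  qed
  then show "w = w'"
    using w by (intro PiE_ext[of w _ _ w']) (auto simp: words_def)
qed

lemma moves_windows_in_PiE:
  assumes k: "k < n" and w: "w \<in> words (k + n * R)"
  shows "moves k R w \<in> {..<R} \<rightarrow>\<^sub>E {0..<m k}" "windows k R w \<in> {..<R} \<rightarrow>\<^sub>E blocks k"
proof -
  have "w (k + n * r + j) < m ((k + j) mod n)" if "r < R" "j < n" for r j
    using words_less[OF w round_bound[OF that]] by (simp only: mod_add_round)
  from this[of _ 0] this have "w (k + n * r) < m k" "window w (k + n * r) \<in> blocks k" if "r < R" for r
    using that k by (auto simp: window_def blocks_def)
  then show "moves k R w \<in> {..<R} \<rightarrow>\<^sub>E {0..<m k}" "windows k R w \<in> {..<R} \<rightarrow>\<^sub>E blocks k"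
    by (auto simp: moves_def windows_def)
qed

lemma image_rounds:
  assumes k: "k < n"
  shows "(\<lambda>w. (restrict w {..<k}, moves k R w, windows k R w)) ` words (k + n * R)
    = words k \<times> ({..<R} \<rightarrow>\<^sub>E {0..<m k}) \<times> ({..<R} \<rightarrow>\<^sub>E blocks k)" (is "?f ` ?W = ?P")
proof (rule card_subset_eq)
  show "finite ?P"
    by (intro finite_cartesian_product finite_PiE) auto
  show "?f ` ?W \<subseteq> ?P"
    by (intro image_subsetI SigmaI moves_windows_in_PiE[OF k] restrict_in_words) auto
  show "card (?f ` ?W) = card ?P"
    using k by (simp add: card_image[OF inj_on_rounds] card_words_rounds card_cartesian_product
        card_PiE card_blocks mult.assoc)
qed

lemma card_words_moves_windows:
  assumes "k < n"
  shows "card {w \<in> words (k + n * R). P (moves k R w) \<and> Q (windows k R w)}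
    = card (words k) * card {f \<in> {..<R} \<rightarrow>\<^sub>E {0..<m k}. P f} * card {g \<in> {..<R} \<rightarrow>\<^sub>E blocks k. Q g}"
    (is "card ?V = card (words k) * card ?X * card ?Y")
proof -
  let ?f = "\<lambda>w. (restrict w {..<k}, moves k R w, windows k R w)"
  have "?f ` ?V = ?f ` words (k + n * R) \<inter> {(h, f, g). P f \<and> Q g}"
    by auto
  also have "\<dots> = words k \<times> ?X \<times> ?Y"
    unfolding image_rounds[OF assms] by auto
  finally have "card (?f ` ?V) = card (words k) * card ?X * card ?Y"
    by (simp add: card_cartesian_product)
  moreover have "inj_on ?f ?V"
    by (rule inj_on_subset[OF inj_on_rounds]) auto
  ultimately show ?thesis
    by (simp add: card_image)
qed

lemma words_rounds_fraction:
  assumes "k < n"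
  shows "card {w \<in> words (k + n * R). P (moves k R w) \<and> Q (windows k R w)} / card (words (k + n * R))
    = card {f \<in> {..<R} \<rightarrow>\<^sub>E {0..<m k}. P f} / real (m k) ^ R
      * (card {g \<in> {..<R} \<rightarrow>\<^sub>E blocks k. Q g} / real (num_contexts k) ^ R)"
proof -
  have "card (words k) \<noteq> 0"
    using assms m_pos by (auto simp: card_words)
  then show ?thesis
    by (simp add: card_words_moves_windows[OF assms] card_words_rounds[OF assms])
qed

lemma words_windows_fraction:
  assumes "k < n"
  shows "card {w \<in> words (k + n * R). Q (windows k R w)} / card (words (k + n * R))
    = card {g \<in> {..<R} \<rightarrow>\<^sub>E blocks k. Q g} / real (num_contexts k) ^ R"
  using words_rounds_fraction[OF assms, of R "\<lambda>_. True" Q] m_pos[OF assms] by (simp add: card_PiE)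

lemma query_eq_imp_move_eqE:
  assumes "query w s = query w s'" "k < n" "s mod n \<noteq> k"
  obtains j r r' where "j \<in> {1..<n}" "s + j = k + n * r" "s' + j = k + n * r'"
    "w (k + n * r) = w (k + n * r')"
proof -
  have same: "s mod n = s' mod n" "window w s = window w s'"
    using assms(1) by (simp_all add: query_eq_iff)
  have "k \<in> (\<lambda>j. (s + j) mod n) ` {1..<n}"
    using assms(2,3) unfolding bij_betw_imp_surj_on[OF bij_betw_add_mod_other[OF n_pos]] by simp
  then obtain j where j: "j \<in> {1..<n}" "(s + j) mod n = k"
    by blast
  moreover have "(s' + j) mod n = k"
    using j(2) same(1) by (metis mod_add_left_eq)
  ultimately have "s + j = k + n * ((s + j) div n)" "s' + j = k + n * ((s' + j) div n)"
    by (metis add.commute mult_div_mod_eq)+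
  moreover have "w (s + j) = w (s' + j)"
    using fun_cong[OF same(2), of j] j(1) by (simp add: window_def)
  ultimately show thesis
    using that j(1) by metis
qed

text \<open>Distinct moves of \<open>k\<close> keep the queries of the other players distinct, since their contexts
  include the last move of \<open>k\<close>.\<close>

lemma inj_on_query:
  assumes k: "k < n" and moves: "inj_on (moves k (Suc R) w) {..<Suc R}"
    and windows: "inj_on (windows k R w) {..<R}"
  shows "inj_on (query w) {..<k + n * R}"
proof (rule inj_onI)
  fix s s' assume s: "s \<in> {..<k + n * R}" "s' \<in> {..<k + n * R}" and eq: "query w s = query w s'"
  have same: "s mod n = s' mod n" "window w s = window w s'"
    using eq by (simp_all add: query_eq_iff)
  show "s = s'"
  proof (cases "s mod n = k")
    case True
    define r r' where "r = s div n" and "r' = s' div n"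
    have r: "s = k + n * r" "s' = k + n * r'"
      using True same(1) unfolding r_def r'_def by (metis add.commute mult_div_mod_eq)+
    moreover from r have "r < R" "r' < R"
      using s by auto
    ultimately show ?thesis
      using inj_onD[OF windows, of r r'] same(2) by (simp add: windows_def)
  next
    case False
    then obtain j r r' where j: "j \<in> {1..<n}" and r: "s + j = k + n * r" "s' + j = k + n * r'"
      and move: "w (k + n * r) = w (k + n * r')"
      using query_eq_imp_move_eqE[OF eq k] by blast
    have "k + n * r < k + n * Suc R" "k + n * r' < k + n * Suc R"
      using s j unfolding r[symmetric] by auto
    then have "r < Suc R" "r' < Suc R"
      by (simp_all del: mult_Suc_right)
    with move have "r = r'"
      using inj_onD[OF moves, of r r'] by (simp add: moves_def)
    with r show ?thesis by simp
  qed
qed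

section \<open>Words with distinct, idle and cyclic windows\<close>

definition distinct_words :: "nat \<Rightarrow> nat \<Rightarrow> (nat \<Rightarrow> nat) set" where
  "distinct_words k R = {w \<in> words (k + n * R). inj_on (windows k R w) {..<R}}"

definition idle_words :: "(nat \<Rightarrow> nat) set" where
  "idle_words = {w \<in> words (n * 2). windows 0 2 w 1 = windows 0 2 w 0}"

definition cyclic_words :: "nat \<Rightarrow> (nat \<Rightarrow> nat) set" where
  "cyclic_words k = {w \<in> words (k + n * 3). inj_on (moves k 3 w) {..<3} \<and>
    windows k 3 w 2 = windows k 3 w 0 \<and> windows k 3 w 1 \<noteq> windows k 3 w 0}"

lemma distinct_words_fraction_le:
  assumes "k < n"
  shows "card (distinct_words k R) / card (words (k + n * R))
    \<le> exp (- (real R * (real R - 1)) / (2 * num_contexts k))"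
  using card_PiE_inj_on_le_exp[OF finite_blocks blocks_nonempty[OF assms], of R]
    words_windows_fraction[OF assms, of R "\<lambda>g. inj_on g {..<R}"]
  by (simp add: distinct_words_def card_blocks[OF assms])

lemma idle_words_fraction: "card idle_words / card (words (n * 2)) = 1 / num_contexts 0"
  using words_windows_fraction[OF n_pos, of 2 "\<lambda>g. g 1 = g 0"]
  unfolding idle_words_def card_PiE_equal_pair card_blocks[OF n_pos]
  by (simp add: power2_eq_square)

lemma cyclic_words_fraction:
  assumes k: "k < n"
  defines "\<mu> \<equiv> real (m k)" and "q \<equiv> real (num_contexts k)"
  shows "card (cyclic_words k) / card (words (k + n * 3))
    = (1 - 1 / \<mu>) * (1 - 2 / \<mu>) * ((1 - 1 / q) / q)"
proof -
  have \<mu>: "2 \<le> m k" and q: "2 \<le> num_contexts k"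
    using m_ge_2 num_contexts_ge_2 k by auto
  have "card {f \<in> {..<3::nat} \<rightarrow>\<^sub>E {0..<m k}. inj_on f {..<3}} = m k * (m k - 1) * (m k - 2)"
    by (simp add: card_PiE_inj_on eval_nat_numeral)
  then have "card (cyclic_words k) / card (words (k + n * 3))
      = real (m k * (m k - 1) * (m k - 2)) / \<mu> ^ 3
        * (real (num_contexts k * (num_contexts k - 1)) / q ^ 3)"
    using words_rounds_fraction[OF k, of 3 "\<lambda>f. inj_on f {..<3}" "\<lambda>g. g 2 = g 0 \<and> g 1 \<noteq> g 0"]
    unfolding cyclic_words_def card_PiE_returning_triple[OF finite_blocks] card_blocks[OF k]
    by (simp add: \<mu>_def q_def)
  also have "\<dots> = \<mu> * (\<mu> - 1) * (\<mu> - 2) / \<mu> ^ 3 * (q * (q - 1) / q ^ 3)"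
    using \<mu> q by (simp add: \<mu>_def q_def of_nat_diff)
  also have "\<mu> * (\<mu> - 1) * (\<mu> - 2) / \<mu> ^ 3 = (1 - 1 / \<mu>) * (1 - 2 / \<mu>)"
    using \<mu> by (simp add: \<mu>_def power3_eq_cube field_simps)
  also have "q * (q - 1) / q ^ 3 = (1 - 1 / q) / q"
    using q by (simp add: q_def power3_eq_cube field_simps)
  finally show ?thesis .
qed

lemma inj_on_query_cyclic_words:
  assumes "k < n" "w \<in> cyclic_words k"
  shows "inj_on (query w) {..<k + n * 2}"
proof (rule inj_on_query[OF assms(1)])
  show "inj_on (moves k (Suc 2) w) {..<Suc 2}"
    using assms(2) by (simp add: cyclic_words_def eval_nat_numeral)
  show "inj_on (windows k 2 w) {..<2}"
    using assms(2) by (auto simp: cyclic_words_def inj_on_def windows_def less_2_cases_iff)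
qed

section \<open>Histories of hitting, idle and cycling runs\<close>

lemma inj_on_query_history:
  assumes a: "a \<in> profiles n m" and H: "enat t < hit_time n m U a" "hit_time n m U a < \<infinity>"
    and "L \<le> t"
  shows "inj_on (query (history (n + L) U a)) {..L}"
proof (rule linorder_inj_onI')
  let ?w = "history (n + L) U a"
  fix s' s assume s: "s' \<in> {..L}" "s \<in> {..L}" "s' < s"
  show "query ?w s' \<noteq> query ?w s"
  proof
    assume "query ?w s' = query ?w s"
    then have "s mod n = s' mod n"
      and "(clockwork n m U a s)(s mod n := 0) = (clockwork n m U a s')(s mod n := 0)"
      using s by (auto simp: query_def state_history[OF a])
    then have "is_PNE n m U (clockwork n m U a (Suc s'))"
      by (intro PNE_if_context_repeats[OF n_pos H(2) s(3)])
    moreover have "Suc s' \<le> t"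
      using s \<open>L \<le> t\<close> by simp
    ultimately show False
      using H(1) by (auto simp: hit_time_greater_iff)
  qed
qed

lemma inj_on_windows:
  assumes "k < n" "inj_on (query w) {..k + n * R}"
  shows "inj_on (windows k (Suc R) w) {..<Suc R}"
proof (rule inj_onI)
  fix r r' assume r: "r \<in> {..<Suc R}" "r' \<in> {..<Suc R}"
    and "windows k (Suc R) w r = windows k (Suc R) w r'"
  then have "query w (k + n * r) = query w (k + n * r')"
    by (simp add: query_eq_iff windows_def)
  moreover have "k + n * r \<in> {..k + n * R}" "k + n * r' \<in> {..k + n * R}"
    using r by (auto simp: less_Suc_eq_le)
  ultimately have "k + n * r = k + n * r'"
    by (rule inj_onD[OF assms(2)])
  then show "r = r'" using n_pos by simp
qed

lemma hit_time_le_1_if_round_repeats: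
  assumes a: "a \<in> profiles n m"
    and repeat: "window (history (n + n) U a) 0 = window (history (n + n) U a) n"
  shows "hit_time n m U a \<le> 1"
proof -
  let ?w = "history (n + n) U a" and ?A = "clockwork n m U a"
  have letter: "?w (n + s) = best_resp m U s (?A s)" if "s < n" for s
    using that by (simp add: history_def)
  have same: "?w (n + s) = ?w s" if "s \<in> {1..<n}" for s
    using fun_cong[OF repeat, of s] that by (simp add: window_def)
  have const: "?A s = ?A 1" if "1 \<le> s" "s \<le> n" for s
    using that
  proof (induction s rule: dec_induct)
    case (step s)
    have "?A s s = ?w s"
      using state_eq_letter[of 0 ?w s] state_history[OF a, of s "n + n" U] step by simp
    also have "\<dots> = best_resp m U s (?A s)"
      using same[of s] letter[of s] step by simp
    finally show ?case
      using step by (simp add: fun_upd_idem)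
  qed simp
  have "?A 1 i = best_resp m U i (?A 1)" if "i < n" for i
  proof (cases "i = 0")
    case False
    then have "?A 1 i = ?A (Suc i) i"
      using const[of "Suc i"] that by simp
    also have "\<dots> = best_resp m U i (?A 1)"
      using const[of i] False that by simp
    finally show ?thesis .
  qed simp
  then have "is_PNE n m U (?A 1)"
    by (simp add: is_PNE_def)
  then show ?thesis
    using hit_time_greater_iff[of 1 n m U a] by (auto simp: one_enat_def not_less[symmetric])
qed

lemma hit_time_infinite_if_cycle:
  assumes a: "a \<in> profiles n m" and k: "k < n"
    and w: "w = history (n + (k + n * 2)) U a"
    and cycle: "window w k = window w (k + n * 2)" "window w k \<noteq> window w (k + n)"
  shows "hit_time n m U a = \<infinity>"
proof (rule ccontr)
  let ?A = "clockwork n m U a"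
  assume "hit_time n m U a \<noteq> \<infinity>"
  then have finite: "hit_time n m U a < \<infinity>" by simp
  have query: "query w s = (s mod n, (?A s)(s mod n := 0))" if "s \<le> k + n * 2" for s
    using that by (simp add: query_def w state_history[OF a])
  have "query w k = query w (k + n * 2)" "query w k \<noteq> query w (k + n)"
    using cycle by (simp_all add: query_eq_iff)
  then have return: "(?A (k + n * 2))(k := 0) = (?A k)(k := 0)"
    and leave: "(?A (k + n))(k := 0) \<noteq> (?A k)(k := 0)"
    using k by (auto simp: query)
  have "is_PNE n m U (?A (Suc k))"
    using k return by (intro PNE_if_context_repeats[OF n_pos finite, of k "k + n * 2"]) auto
  then have stays: "?A s = ?A (Suc k)" if "Suc k \<le> s" for s
    using that by (rule clockwork_PNE_stays[OF n_pos])
  have "?A (k + n) = ?A (k + n * 2)"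
    using n_ge_2 by (simp add: stays)
  with return leave show False by simp
qed

end

section \<open>Best responses are independent and uniform\<close>

locale atomless_game = game_params +
  fixes D :: "real measure"
  assumes prob_space_D: "prob_space D" and sets_D: "sets D = sets borel"
    and atomless: "emeasure D {x} = 0"
begin

abbreviation entries :: "(nat \<times> (nat \<Rightarrow> nat)) set" where
  "entries \<equiv> {0..<n} \<times> profiles n m"

abbreviation payoffs :: "payoff measure" where
  "payoffs \<equiv> PiM entries (\<lambda>_. D)"

sublocale payoffs: prob_space payoffs
  using prob_space_D by (intro prob_space_PiM)

lemma measurable_best_resp:
  assumes "(i, c) \<in> slots"
  shows "(\<lambda>U. best_resp m U i c) \<in> payoffs \<rightarrow>\<^sub>M count_space {0..<m i}"
proof -
  have entry: "(\<lambda>U. U (i, c(i := y))) \<in> borel_measurable payoffs" if "y < m i" for y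
    using measurable_component_singleton[of "(i, c(i := y))" entries "\<lambda>_. D"] assms that
      profiles_update by (simp add: slots_def measurable_cong_sets[OF refl sets_D])
  have "Measurable.pred payoffs (\<lambda>U. U (i, c(i := y)) \<le> U (i, c(i := x)))"
    if "x < m i" "y < m i" for x y
    using borel_measurable_le[OF entry entry] that by (simp add: pred_def)
  then have "(\<lambda>U. best_resp m U i c) \<in> payoffs \<rightarrow>\<^sub>M count_space UNIV"
    unfolding best_resp_def
    by (intro measurable_Least pred_intros_conj1' pred_intros_countable(1) pred_intros_imp')
  then show ?thesis
    using assms by (auto simp: measurable_count_space_eq2 measurable_count_space_eq2_countable
        slots_def intro!: best_resp_less m_pos)
qed

definition relabel_entry ::
    "(nat \<times> (nat \<Rightarrow> nat) \<Rightarrow> nat \<Rightarrow> nat) \<Rightarrow> nat \<times> (nat \<Rightarrow> nat) \<Rightarrow> nat \<times> (nat \<Rightarrow> nat)" where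
  "relabel_entry \<sigma> = (\<lambda>(i, a). (i, a(i := \<sigma> (i, a(i := 0)) (a i))))"

definition relabel :: "(nat \<times> (nat \<Rightarrow> nat) \<Rightarrow> nat \<Rightarrow> nat) \<Rightarrow> payoff \<Rightarrow> payoff" where
  "relabel \<sigma> U = (\<lambda>p\<in>entries. U (relabel_entry \<sigma> p))"

context
  fixes \<sigma> :: "nat \<times> (nat \<Rightarrow> nat) \<Rightarrow> nat \<Rightarrow> nat"
  assumes \<sigma>: "\<And>p. p \<in> slots \<Longrightarrow> \<sigma> p permutes {..<m (fst p)}"
begin

lemma relabel_entry_in_entries: "relabel_entry \<sigma> \<in> entries \<rightarrow> entries"
proof
  fix p assume "p \<in> entries"
  then obtain i a where p: "p = (i, a)" and i: "i < n" and a: "a \<in> profiles n m" by auto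
  have "\<sigma> (i, a(i := 0)) (a i) < m i"
    using permutes_in_image[OF \<sigma>[OF slot_of_profile[OF a i]], of "a i"] profiles_less[OF a i] by simp
  with i a show "relabel_entry \<sigma> p \<in> entries"
    by (simp add: p relabel_entry_def profiles_update)
qed

lemma inj_on_relabel_entry: "inj_on (relabel_entry \<sigma>) entries"
proof (rule inj_onI)
  fix p q assume "p \<in> entries" "q \<in> entries" and eq: "relabel_entry \<sigma> p = relabel_entry \<sigma> q"
  then obtain i a b where pq: "p = (i, a)" "q = (i, b)" and i: "i < n" and a: "a \<in> profiles n m"
    by (cases p; cases q) (auto simp: relabel_entry_def)
  have upd: "a(i := \<sigma> (i, a(i := 0)) (a i)) = b(i := \<sigma> (i, b(i := 0)) (b i))"
    using eq by (simp add: pq relabel_entry_def)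
  then have others: "a(i := x) = b(i := x)" for x
    by (metis fun_upd_upd)
  have "\<sigma> (i, a(i := 0)) (a i) = \<sigma> (i, a(i := 0)) (b i)"
    using fun_cong[OF upd, of i] by (simp add: others)
  then have "a i = b i"
    using permutes_inj[OF \<sigma>[OF slot_of_profile[OF a i]]] by (simp add: inj_eq)
  with others[of "a i"] show "p = q"
    unfolding pq by (metis fun_upd_triv)
qed

lemma measurable_relabel: "relabel \<sigma> \<in> payoffs \<rightarrow>\<^sub>M payoffs"
  unfolding relabel_def using relabel_entry_in_entries
  by (intro measurable_restrict measurable_component_singleton) auto

lemma distr_relabel: "distr payoffs payoffs (relabel \<sigma>) = payoffs"
  unfolding relabel_def
  using distr_PiM_reindex[OF prob_space_D inj_on_relabel_entry relabel_entry_in_entries] by simp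

end

lemma best_resp_relabel:
  assumes ic: "(i, c) \<in> slots" and \<sigma>: "\<sigma> (i, c) permutes {..<m i}" and U: "inj_on U entries"
  shows "\<sigma> (i, c) (best_resp m (relabel \<sigma> U) i c) = best_resp m U i c"
proof -
  let ?x = "best_resp m (relabel \<sigma> U) i c"
  have i: "i < n" and c: "c \<in> profiles n m" "c(i := 0) = c"
    using ic by (auto simp: slots_def)
  have entry: "(i, c(i := y)) \<in> entries" if "y < m i" for y
    using i c that profiles_update by simp
  have relabel: "relabel \<sigma> U (i, c(i := y)) = U (i, c(i := \<sigma> (i, c) y))" if "y < m i" for y
    using entry[OF that] c by (simp add: relabel_def relabel_entry_def)
  have x: "?x < m i"
    using i m_pos by (intro best_resp_less)
  have "best_resp m U i c = \<sigma> (i, c) ?x"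
  proof (rule best_resp_eqI)
    show "\<sigma> (i, c) ?x < m i"
      using x permutes_in_image[OF \<sigma>] by simp
    fix y assume y: "y < m i" "y \<noteq> \<sigma> (i, c) ?x"
    obtain z where z: "z < m i" "y = \<sigma> (i, c) z"
      using y(1) permutes_image[OF \<sigma>] by (metis imageE lessThan_iff)
    have "U (i, c(i := y)) \<le> U (i, c(i := \<sigma> (i, c) ?x))"
      using best_resp_ge[of z m i "relabel \<sigma> U" c] by (simp add: relabel z x)
    moreover have "c(i := y) \<noteq> c(i := \<sigma> (i, c) ?x)"
      using y(2) by (metis fun_upd_same)
    then have "U (i, c(i := y)) \<noteq> U (i, c(i := \<sigma> (i, c) ?x))"
      using inj_onD[OF U _ entry entry] y(1) \<open>\<sigma> (i, c) ?x < m i\<close> by blast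
    ultimately show "U (i, c(i := y)) < U (i, c(i := \<sigma> (i, c) ?x))"
      by simp
  qed
  then show ?thesis by simp
qed

lemma measurable_responses_on:
  assumes "J \<subseteq> slots"
  shows "responses_on J \<in> payoffs \<rightarrow>\<^sub>M count_space (PiE J (\<lambda>p. {0..<m (fst p)}))"
proof -
  have "responses_on J \<in> payoffs \<rightarrow>\<^sub>M PiM J (\<lambda>p. count_space {0..<m (fst p)})"
    unfolding responses_on_def using assms measurable_best_resp
    by (intro measurable_restrict) (metis prod.collapse subsetD)
  then show ?thesis
    using finite_subset[OF assms finite_slots] by (simp add: count_space_PiM_finite)
qed

lemma measure_responses_on_eq:
  assumes J: "J \<subseteq> slots" and v: "v \<in> PiE J (\<lambda>p. {0..<m (fst p)})" "v' \<in> PiE J (\<lambda>p. {0..<m (fst p)})"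
  shows "\<P>(U in payoffs. responses_on J U = v) = \<P>(U in payoffs. responses_on J U = v')"
proof -
  define \<sigma> where "\<sigma> p = (if p \<in> J then Transposition.transpose (v p) (v' p) else id)" for p
  have \<sigma>: "\<sigma> p permutes {..<m (fst p)}" if "p \<in> slots" for p
    using v by (auto simp: \<sigma>_def PiE_iff intro: permutes_swap_id)
  have [measurable]: "responses_on J \<in> payoffs \<rightarrow>\<^sub>M count_space (PiE J (\<lambda>p. {0..<m (fst p)}))"
    by (rule measurable_responses_on[OF J])
  have "responses_on J U = v \<longleftrightarrow> responses_on J (relabel \<sigma> U) = v'" if U: "inj_on U entries" for U
  proof -
    have "best_resp m U i c = v (i, c) \<longleftrightarrow> best_resp m (relabel \<sigma> U) i c = v' (i, c)"
      if "(i, c) \<in> J" for i c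
    proof -
      have "(i, c) \<in> slots" using J that by blast
      then have "best_resp m U i c = \<sigma> (i, c) (best_resp m (relabel \<sigma> U) i c)"
        using best_resp_relabel[OF _ _ U] \<sigma> by fastforce
      then show ?thesis
        using that by (auto simp: \<sigma>_def Transposition.transpose_def split: if_splits)
    qed
    then show ?thesis
      using v by (force simp: responses_on_eq_iff PiE_iff)
  qed
  then have "AE U in payoffs. responses_on J U = v \<longleftrightarrow> responses_on J (relabel \<sigma> U) = v'"
    using AE_PiM_inj_on[OF prob_space_D sets_D atomless, of entries] by (auto elim: eventually_mono)
  then have "\<P>(U in payoffs. responses_on J U = v)
      = \<P>(U in payoffs. responses_on J (relabel \<sigma> U) = v')"
    using measurable_relabel[OF \<sigma>] by (intro measure_eq_AE) auto
  also have "\<dots> = \<P>(U in distr payoffs payoffs (relabel \<sigma>). responses_on J U = v')"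
    using measurable_relabel[OF \<sigma>]
    by (subst measure_distr) (auto intro!: arg_cong[where f = "measure _"] dest: measurable_space)
  finally show ?thesis
    by (simp add: distr_relabel[OF \<sigma>])
qed

lemma measure_responses_on:
  assumes J: "J \<subseteq> slots" and v: "v \<in> PiE J (\<lambda>p. {0..<m (fst p)})"
  shows "\<P>(U in payoffs. responses_on J U = v) = 1 / (\<Prod>p\<in>J. m (fst p))"
proof -
  let ?V = "PiE J (\<lambda>p. {0..<m (fst p)})" and ?E = "\<lambda>v. {U \<in> space payoffs. responses_on J U = v}"
  have "finite J"
    using J by (rule finite_subset) simp
  then have V: "finite ?V" "card ?V = (\<Prod>p\<in>J. m (fst p))"
    by (auto simp: card_PiE intro: finite_PiE)
  have "1 = payoffs.prob (\<Union>v\<in>?V. ?E v)"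
    using responses_on_in_PiE[OF J] payoffs.prob_space
    by (auto intro!: arg_cong[where f = payoffs.prob] simp flip: payoffs.prob_space)
  also have "\<dots> = (\<Sum>v'\<in>?V. payoffs.prob (?E v'))"
    using V measurable_responses_on[OF J]
    by (intro payoffs.finite_measure_finite_Union) (auto simp: disjoint_family_on_def)
  also have "\<dots> = (\<Sum>v'\<in>?V. payoffs.prob (?E v))"
    using v by (intro sum.cong refl measure_responses_on_eq J)
  finally have "1 = (\<Prod>p\<in>J. m (fst p)) * payoffs.prob (?E v)"
    using V by simp
  then show ?thesis
    by (simp add: eq_divide_eq mult.commute) auto
qed

lemma best_resp_outside:
  assumes U: "U \<in> extensional entries" and "i < n" "a(i := 0) \<notin> profiles n m"
  shows "best_resp m U i a = 0"
proof -
  have "a(i := x) \<notin> profiles n m" for x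
    using profiles_update[of "a(i := x)" i 0] m_pos assms(2,3) by auto
  then have "U (i, a(i := x)) = undefined" for x
    using U by (simp add: extensional_def)
  then show ?thesis
    using m_pos[OF \<open>i < n\<close>] unfolding best_resp_def by (intro Least_equality) auto
qed

lemma best_resp_cong_responses_on:
  assumes "U \<in> extensional entries" "V \<in> extensional entries"
    and eq: "responses_on slots U = responses_on slots V" and "i < n"
  shows "best_resp m U i a = best_resp m V i a"
proof (cases "a(i := 0) \<in> profiles n m")
  case True
  then have "(i, a(i := 0)) \<in> slots"
    using slot_of_profile[of "a(i := 0)" i] \<open>i < n\<close> by simp
  then show ?thesis
    using fun_cong[OF eq, of "(i, a(i := 0))"] by (simp add: responses_on_def)
qed (simp add: best_resp_outside assms)

definition depends_on_responses :: "(payoff \<Rightarrow> (nat \<Rightarrow> nat) \<Rightarrow> bool) \<Rightarrow> bool" where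
  "depends_on_responses \<Phi> \<longleftrightarrow>
    (\<forall>U V a. (\<forall>i<n. \<forall>b. best_resp m U i b = best_resp m V i b) \<longrightarrow> \<Phi> U a = \<Phi> V a)"

abbreviation game_event :: "(payoff \<Rightarrow> (nat \<Rightarrow> nat) \<Rightarrow> bool) \<Rightarrow> (payoff \<times> (nat \<Rightarrow> nat)) set" where
  "game_event \<Phi> \<equiv> {\<omega> \<in> space (game_space n m D). \<Phi> (fst \<omega>) (snd \<omega>)}"

text \<open>The initial profile formally ranges over all functions, not only over profiles, so measurability
  rests on the event depending on the payoffs through finitely many responses.\<close>

lemma sets_game_event:
  assumes "depends_on_responses \<Phi>"
  shows "game_event \<Phi> \<in> sets (game_space n m D)"
proof -
  let ?G = "game_space n m D" and ?V = "PiE slots (\<lambda>p. {0..<m (fst p)})"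
  define \<Psi> where "\<Psi> v a \<longleftrightarrow> (\<exists>U\<in>extensional entries. responses_on slots U = v \<and> \<Phi> U a)" for v a
  have ext: "fst \<omega> \<in> extensional entries" if "\<omega> \<in> space ?G" for \<omega>
    using that by (auto simp: game_space_def space_pair_measure space_PiM PiE_iff)
  have "\<Phi> (fst \<omega>) (snd \<omega>) \<longleftrightarrow> \<Psi> (responses_on slots (fst \<omega>)) (snd \<omega>)" if "\<omega> \<in> space ?G" for \<omega>
  proof
    assume "\<Phi> (fst \<omega>) (snd \<omega>)"
    then show "\<Psi> (responses_on slots (fst \<omega>)) (snd \<omega>)"
      using ext[OF that] by (auto simp: \<Psi>_def)
  next
    assume "\<Psi> (responses_on slots (fst \<omega>)) (snd \<omega>)"
    then obtain U where "U \<in> extensional entries" "responses_on slots U = responses_on slots (fst \<omega>)"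
      and U: "\<Phi> U (snd \<omega>)"
      by (auto simp: \<Psi>_def)
    then have "best_resp m U i b = best_resp m (fst \<omega>) i b" if "i < n" for i b
      using ext[OF \<open>\<omega> \<in> space ?G\<close>] that by (intro best_resp_cong_responses_on)
    with U assms show "\<Phi> (fst \<omega>) (snd \<omega>)"
      unfolding depends_on_responses_def by blast
  qed
  moreover have "Measurable.pred ?G (\<lambda>\<omega>. \<Psi> (responses_on slots (fst \<omega>)) (snd \<omega>))"
  proof (rule measurable_compose_countable'[where I = ?V])
    show "(\<lambda>\<omega>. responses_on slots (fst \<omega>)) \<in> ?G \<rightarrow>\<^sub>M count_space ?V"
      unfolding game_space_def
      by (rule measurable_compose[OF measurable_fst measurable_responses_on]) simp
    show "Measurable.pred ?G (\<lambda>\<omega>. \<Psi> v (snd \<omega>))" for v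
      unfolding game_space_def by (rule measurable_compose[OF measurable_snd]) simp
    show "countable ?V"
      by (intro countable_finite finite_PiE) auto
  qed
  ultimately show ?thesis
    by (simp add: pred_def cong: conj_cong)
qed

sublocale game: prob_space "game_space n m D"
proof -
  interpret pair_prob_space payoffs "measure_pmf (pmf_of_set (profiles n m))" ..
  show "prob_space (game_space n m D)"
    unfolding game_space_def by (rule prob_space_axioms)
qed

lemma AE_game_profiles: "AE \<omega> in game_space n m D. snd \<omega> \<in> profiles n m"
proof -
  interpret pair_prob_space payoffs "measure_pmf (pmf_of_set (profiles n m))" ..
  have "game_event (\<lambda>_ a. a \<in> profiles n m) \<in> sets (game_space n m D)"
    by (rule sets_game_event) (simp add: depends_on_responses_def)
  then show ?thesis
    unfolding game_space_def
    by (intro AE_pair_measure) (simp_all add: AE_measure_pmf_iff set_pmf_of_set profiles_nonempty)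
qed

lemma depends_on_responses_history: "depends_on_responses (\<lambda>U a. P (history N U a) a)"
proof -
  have "history N U a = history N V a"
    if "\<And>i b. i < n \<Longrightarrow> best_resp m U i b = best_resp m V i b" for U V a
    unfolding history_def using clockwork_cong[OF n_pos that] that by auto
  then show ?thesis
    unfolding depends_on_responses_def by metis
qed

lemma depends_on_responses_hit_time: "depends_on_responses (\<lambda>U a. P (hit_time n m U a))"
  unfolding depends_on_responses_def using hit_time_cong[OF n_pos] by metis

abbreviation history_event :: "nat \<Rightarrow> (nat \<Rightarrow> nat) set \<Rightarrow> (payoff \<times> (nat \<Rightarrow> nat)) set" where
  "history_event N W \<equiv> game_event (\<lambda>U a. a \<in> profiles n m \<and> history N U a \<in> W)"

lemma prob_history_event_singleton:
  assumes w: "w \<in> words (n + L)" and fresh: "inj_on (query w) {..<L}"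
  shows "game.prob (history_event (n + L) {w})
    = 1 / card (words (n + L))"
proof -
  let ?J = "query w ` {..<L}" and ?a = "restrict w {0..<n}"
    and ?Q = "measure_pmf (pmf_of_set (profiles n m))"
  have J: "?J \<subseteq> slots"
    using query_in_slots[OF w] by auto
  have a: "?a \<in> profiles n m"
    using state_in_profiles[OF w, of 0] by simp
  have "b \<in> profiles n m \<and> history (n + L) U b = w \<longleftrightarrow> responses_on ?J U = answers L w \<and> b = ?a"
    for U b
    using history_eq_iff[OF _ w fresh] a by metis
  then have "history_event (n + L) {w} = {U \<in> space payoffs. responses_on ?J U = answers L w} \<times> {?a}"
    by (auto simp: game_space_def space_pair_measure)
  then have "game.prob (history_event (n + L) {w})
      = \<P>(U in payoffs. responses_on ?J U = answers L w) * measure ?Q {?a}"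
    using measurable_responses_on[OF J]
    by (simp add: game_space_def measure_def measure_pmf.emeasure_pair_measure_Times enn2real_mult)
  also have "\<dots> = 1 / (\<Prod>p\<in>?J. m (fst p)) * (1 / card (profiles n m))"
    using measure_responses_on[OF J answers_in_PiE[OF w fresh]] a profiles_nonempty
    by (simp add: measure_pmf_single)
  also have "(\<Prod>p\<in>?J. m (fst p)) = (\<Prod>s<L. m (s mod n))"
    by (subst prod.reindex[OF fresh]) (simp add: query_def)
  also have "1 / real (\<Prod>s<L. m (s mod n)) * (1 / card (profiles n m)) = 1 / card (words (n + L))"
    by (simp add: card_words card_profiles prod_lessThan_add)
  finally show ?thesis .
qed

lemma prob_history_event:
  assumes W: "W \<subseteq> words (n + L)" and fresh: "\<And>w. w \<in> W \<Longrightarrow> inj_on (query w) {..<L}"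
  shows "game.prob (history_event (n + L) W)
    = card W / card (words (n + L))"
proof -
  have "finite W"
    using W by (rule finite_subset) simp
  have "game.prob (\<Union>w\<in>W. history_event (n + L) {w}) = (\<Sum>w\<in>W. game.prob (history_event (n + L) {w}))"
    using \<open>finite W\<close> sets_game_event[OF depends_on_responses_history]
    by (intro game.finite_measure_finite_Union) (auto simp: disjoint_family_on_def)
  also have "\<dots> = (\<Sum>w\<in>W. 1 / card (words (n + L)))"
    using W fresh by (intro sum.cong refl prob_history_event_singleton) auto
  also have "(\<Union>w\<in>W. history_event (n + L) {w}) = history_event (n + L) W"
    by auto
  finally show ?thesis by simp
qed

section \<open>Hitting probabilities\<close>

abbreviation prob_hit_time :: "(enat \<Rightarrow> bool) \<Rightarrow> real" where
  "prob_hit_time P \<equiv> game.prob (game_event (\<lambda>U a. P (hit_time n m U a)))"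

lemma prob_hit_time_le_fraction:
  assumes N: "N = n + L" and W: "W \<subseteq> words N" "\<And>w. w \<in> W \<Longrightarrow> inj_on (query w) {..<L}"
    and history: "\<And>U a. a \<in> profiles n m \<Longrightarrow> P (hit_time n m U a) \<Longrightarrow> history N U a \<in> W"
  shows "prob_hit_time P \<le> card W / card (words N)"
proof -
  have "prob_hit_time P \<le> game.prob (history_event N W)"
  proof (rule game.finite_measure_mono_AE)
    show "AE \<omega> in game_space n m D. \<omega> \<in> game_event (\<lambda>U a. P (hit_time n m U a)) \<longrightarrow> \<omega> \<in> history_event N W"
      using AE_game_profiles by eventually_elim (auto intro: history)
  qed (rule sets_game_event[OF depends_on_responses_history])
  also have "\<dots> = card W / card (words N)"
    using W unfolding N by (rule prob_history_event)
  finally show ?thesis .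
qed

lemma fraction_le_prob_hit_time:
  assumes N: "N = n + L" and W: "W \<subseteq> words N" "\<And>w. w \<in> W \<Longrightarrow> inj_on (query w) {..<L}"
    and history: "\<And>U a. a \<in> profiles n m \<Longrightarrow> history N U a \<in> W \<Longrightarrow> P (hit_time n m U a)"
  shows "card W / card (words N) \<le> prob_hit_time P"
proof -
  have "card W / card (words N) = game.prob (history_event N W)"
    using W unfolding N by (rule prob_history_event[symmetric])
  also have "\<dots> \<le> prob_hit_time P"
    by (intro game.finite_measure_mono sets_game_event[OF depends_on_responses_hit_time])
      (auto intro: history)
  finally show ?thesis .
qed

lemma prob_hit_time_add3_le_1:
  assumes "\<And>h. \<not> (P h \<and> Q h)" "\<And>h. \<not> (P h \<and> R h)" "\<And>h. \<not> (Q h \<and> R h)"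
  shows "prob_hit_time P + prob_hit_time Q + prob_hit_time R \<le> 1"
proof -
  let ?E = "\<lambda>P. game_event (\<lambda>U a. P (hit_time n m U a))"
  have sets: "?E P \<in> game.events" for P
    by (rule sets_game_event[OF depends_on_responses_hit_time])
  have "?E P \<inter> ?E Q = {}" "(?E P \<union> ?E Q) \<inter> ?E R = {}"
    using assms by blast+
  then have "prob_hit_time P + prob_hit_time Q + prob_hit_time R = game.prob (?E P \<union> ?E Q \<union> ?E R)"
    using sets by (simp add: game.finite_measure_Union sets.Un)
  then show ?thesis by simp
qed

lemma prob_hit_after_rounds_le:
  assumes k: "k < n" and t: "k + n * R \<le> t"
  shows "prob_hit_time (\<lambda>h. enat t < h \<and> h < \<infinity>)
    \<le> exp (- (real (Suc R) * real R) / (2 * num_contexts k))"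
proof -
  let ?L = "k + n * R" and ?N = "k + n * Suc R"
  let ?W = "{w \<in> distinct_words k (Suc R). inj_on (query w) {..<?L}}"
  have length: "?N = n + ?L" by simp
  have "prob_hit_time (\<lambda>h. enat t < h \<and> h < \<infinity>) \<le> card ?W / card (words ?N)"
  proof (rule prob_hit_time_le_fraction[OF length])
    show "?W \<subseteq> words ?N"
      unfolding distinct_words_def by blast
    show "inj_on (query w) {..<?L}" if "w \<in> ?W" for w
      using that by blast
    fix U a assume a: "a \<in> profiles n m"
      and H: "enat t < hit_time n m U a \<and> hit_time n m U a < \<infinity>"
    let ?w = "history ?N U a"
    have inj: "inj_on (query ?w) {..?L}"
      unfolding length using H t by (intro inj_on_query_history[OF a]) auto
    then have "?w \<in> distinct_words k (Suc R)"
      unfolding distinct_words_def using history_in_words[OF a] inj_on_windows[OF k] by blast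
    moreover have "inj_on (query ?w) {..<?L}"
      using inj by (rule inj_on_subset) auto
    ultimately show "?w \<in> ?W" by blast
  qed
  also have "\<dots> \<le> card (distinct_words k (Suc R)) / card (words ?N)"
    by (intro divide_right_mono of_nat_mono card_mono) (auto simp: distinct_words_def)
  also have "\<dots> \<le> exp (- (real (Suc R) * (real (Suc R) - 1)) / (2 * num_contexts k))"
    by (rule distinct_words_fraction_le[OF k])
  finally show ?thesis by simp
qed

lemma prob_hit_at_1_ge: "1 / num_contexts 0 \<le> prob_hit_time (\<lambda>h. h \<le> 1)"
  unfolding idle_words_fraction[symmetric]
proof (rule fraction_le_prob_hit_time)
  show length: "n * 2 = n + n" by simp
  show "idle_words \<subseteq> words (n * 2)"
    unfolding idle_words_def by blast
  show "inj_on (query w) {..<n}" for w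
    by (auto simp: inj_on_def query_eq_iff)
  show "hit_time n m U a \<le> 1" if "a \<in> profiles n m" "history (n * 2) U a \<in> idle_words" for U a
    using that hit_time_le_1_if_round_repeats[of a U] unfolding length
    by (simp add: idle_words_def windows_def)
qed

lemma prob_never_hit_ge:
  assumes k: "k < n"
  defines "\<mu> \<equiv> real (m k)" and "q \<equiv> real (num_contexts k)"
  shows "(1 - 1 / \<mu>) * (1 - 2 / \<mu>) * ((1 - 1 / q) / q) \<le> prob_hit_time (\<lambda>h. h = \<infinity>)"
  unfolding \<mu>_def q_def cyclic_words_fraction[OF k, symmetric]
proof (rule fraction_le_prob_hit_time)
  show length: "k + n * 3 = n + (k + n * 2)" by simp
  show "cyclic_words k \<subseteq> words (k + n * 3)"
    unfolding cyclic_words_def by blast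
  show "inj_on (query w) {..<k + n * 2}" if "w \<in> cyclic_words k" for w
    using k that by (rule inj_on_query_cyclic_words)
  show "hit_time n m U a = \<infinity>" if a: "a \<in> profiles n m" and "history (k + n * 3) U a \<in> cyclic_words k"
    for U a
    using that(2) unfolding length cyclic_words_def
    by (intro hit_time_infinite_if_cycle[OF a k refl]) (auto simp: windows_def)
qed

lemma prob_hit_after_le:
  assumes k: "k < n" and "1 \<le> t"
  shows "prob_hit_time (\<lambda>h. enat t < h \<and> h < \<infinity>) \<le> exp (- 1 / (2 * num_contexts k))"
proof -
  define \<mu> q where "\<mu> = real (m k)" and "q = real (num_contexts k)"
  have \<mu>2: "2 \<le> \<mu>" and q2: "2 \<le> q"
    using m_ge_2 num_contexts_ge_2 k by (auto simp: \<mu>_def q_def)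
  have "2 * num_contexts 0 \<le> m 0 * num_contexts 0"
    using m_ge_2[of 0] by simp
  also have "\<dots> = m k * num_contexts k"
    using num_contexts_mult[OF k] num_contexts_mult[OF n_pos] by (simp add: mult.commute)
  finally have "2 * real (num_contexts 0) \<le> \<mu> * q"
    unfolding \<mu>_def q_def by (metis of_nat_le_iff of_nat_mult of_nat_numeral)
  then have "2 / \<mu> * (1 / q) \<le> 1 / num_contexts 0"
    using \<mu>2 q2 num_contexts_ge_2[OF n_pos] by (simp add: field_simps)
  then have "1 / (2 * q) \<le> prob_hit_time (\<lambda>h. h \<le> 1) + prob_hit_time (\<lambda>h. h = \<infinity>)"
    using inverse_twice_le[OF \<mu>2 q2] prob_hit_at_1_ge prob_never_hit_ge[OF k]
    unfolding \<mu>_def q_def by linarith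
  moreover have "prob_hit_time (\<lambda>h. enat t < h \<and> h < \<infinity>) + prob_hit_time (\<lambda>h. h \<le> 1)
      + prob_hit_time (\<lambda>h. h = \<infinity>) \<le> 1"
    using \<open>1 \<le> t\<close> by (intro prob_hit_time_add3_le_1) (auto simp: one_enat_def dest: enat_ile)
  ultimately have "prob_hit_time (\<lambda>h. enat t < h \<and> h < \<infinity>) \<le> 1 + - 1 / (2 * q)"
    by simp
  also have "\<dots> \<le> exp (- 1 / (2 * q))"
    by (rule exp_ge_add_one_self)
  finally show ?thesis
    by (simp add: q_def)
qed

lemma prob_hit_after_div_le:
  assumes k: "k < n" and "1 \<le> t"
  shows "prob_hit_time (\<lambda>h. enat t < h \<and> h < \<infinity>)
    \<le> exp (- (real (t div n) - 1)\<^sup>2 / (2 * real (num_contexts k)))"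
proof (cases "t div n")
  case 0
  then show ?thesis
    using prob_hit_after_le[OF k \<open>1 \<le> t\<close>] by simp
next
  case (Suc R)
  have "n * Suc R \<le> t"
    unfolding Suc[symmetric] by simp
  then have "k + n * R \<le> t"
    using k by simp
  from prob_hit_after_rounds_le[OF k this] show ?thesis
    by (rule order_trans) (simp add: Suc power2_eq_square divide_right_mono mult_right_mono)
qed

end

theorem lemma1:
  fixes n :: nat and m :: "nat \<Rightarrow> nat" and D :: "real measure" and t :: nat
  assumes "n \<ge> 2"
    and "\<And>i. i < n \<Longrightarrow> m i \<ge> 2"
    and "prob_space D" and "sets D = sets borel"
    and "\<And>x. emeasure D {x} = 0"
    and "t \<ge> 1"
  shows "{\<omega> \<in> space (game_space n m D).
            enat t < hit_time n m (fst \<omega>) (snd \<omega>) \<and> hit_time n m (fst \<omega>) (snd \<omega>) < \<infinity>}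
           \<in> sets (game_space n m D)
       \<and> measure (game_space n m D)
           {\<omega> \<in> space (game_space n m D).
              enat t < hit_time n m (fst \<omega>) (snd \<omega>) \<and> hit_time n m (fst \<omega>) (snd \<omega>) < \<infinity>}
         \<le> exp (- (real_of_int \<lfloor>real t / real n - 1\<rfloor>)\<^sup>2 / (2 * q_nm n m))"
proof -
  interpret atomless_game n m D
    by (intro atomless_game.intro game_params.intro atomless_game_axioms.intro assms)
  have "Max (m ` {0..<n}) \<in> m ` {0..<n}"
    by (intro Max_in) auto
  then obtain k where k: "k < n" "m k = Max (m ` {0..<n})"
    by (metis atLeastLessThan_iff imageE)
  have floor: "real_of_int \<lfloor>real t / real n - 1\<rfloor> = real (t div n) - 1"
    by (simp add: floor_divide_of_nat_eq)
  show ?thesis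
    unfolding floor q_nm_eq_num_contexts[OF k]
    by (intro conjI prob_hit_after_div_le[OF k(1) \<open>t \<ge> 1\<close>]
        sets_game_event[OF depends_on_responses_hit_time, of "\<lambda>h. enat t < h \<and> h < \<infinity>"])
qed

end
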